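(* Let $D$ be a non-square positive integer, let $(\alpha,\beta)$ be the fundamental solution of $x^2-Dy^2=1$, let $f=u+v$ and let $g=f^{-1}$. Then for any real number $x\ge 1$, $$g(x)=\frac{1}{\log(\alpha+\beta\sqrt{D})}\cosh^{-1}\left(\frac{Dx-\sqrt{Dx^2-D+1}}{D-1}\right),$$ where $\cosh^{-1}$ is the inverse hyperbolic cosine function. Equivalently, $$g(x)=\frac{\log\left(Dx-\sqrt{Dx^2-D+1}+\sqrt{D}\sqrt{(D+1)x^2-D+1-2x\sqrt{Dx^2-D+1}}\right)-\log(D-1)}{\log(\alpha+\beta\sqrt{D})}.$$
   Context: Let $D$ be a non-square positive integer. The fundamental solution $(\alpha,\beta)$ of the Pell equation $x^2-Dy^2=1$ is the solution in positive integers with the smallest value of $x+y\sqrt{D}$ among all positive integer solutions. Define $u:[0,\infty)\to[1,\infty)$ and $v:[0,\infty)\to[0,\infty)$ by $$u(x)=\tfrac12\left\{(\alpha+\beta\sqrt{D})^x+(\alpha-\beta\sqrt{D})^x\right\},\qquad v(x)=\tfrac{1}{2\sqrt{D}}\left\{(\alpha+\beta\sqrt{D})^x-(\alpha-\beta\sqrt{D})^x\right\}.$$ The function $f:[0,\infty)\to[1,\infty)$, $f=u+v$, is a strictly increasing bijection, and $g:=f^{-1}:[1,\infty)\to[0,\infty)$ denotes its inverse. The function $\cosh^{-1}:[1,\infty)\to[0,\infty)$ is the inverse of $\cosh$ restricted to $[0,\infty)$. *)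

theory Defs
  imports "HOL-Analysis.Analysis" "HOL-Computational_Algebra.Nth_Powers"
begin

definition pell_pos_solution :: "int \<Rightarrow> int \<Rightarrow> int \<Rightarrow> bool" where
  "pell_pos_solution D x y \<longleftrightarrow> 0 < x \<and> 0 < y \<and> x\<^sup>2 - D * y\<^sup>2 = 1"

definition pell_fundamental_solution :: "int \<Rightarrow> int \<Rightarrow> int \<Rightarrow> bool" where
  "pell_fundamental_solution D \<alpha> \<beta> \<longleftrightarrow>
     pell_pos_solution D \<alpha> \<beta> \<and>
     (\<forall>x y. pell_pos_solution D x y \<longrightarrow>
        real_of_int \<alpha> + real_of_int \<beta> * sqrt (real_of_int D)
          \<le> real_of_int x + real_of_int y * sqrt (real_of_int D))"

text \<open>
  The functions \<open>u\<close>, \<open>v\<close> and \<open>f\<close> are meant on \<open>[0,\<infinity>)\<close> only. Both bases of \<open>powr\<close> are positive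
  for a positive solution of the Pell equation, since their product is \<open>1\<close>.
\<close>

definition pell_u :: "int \<Rightarrow> int \<Rightarrow> int \<Rightarrow> real \<Rightarrow> real" where
  "pell_u D \<alpha> \<beta> x =
     1 / 2 * ((real_of_int \<alpha> + real_of_int \<beta> * sqrt (real_of_int D)) powr x
            + (real_of_int \<alpha> - real_of_int \<beta> * sqrt (real_of_int D)) powr x)"

definition pell_v :: "int \<Rightarrow> int \<Rightarrow> int \<Rightarrow> real \<Rightarrow> real" where
  "pell_v D \<alpha> \<beta> x =
     1 / (2 * sqrt (real_of_int D)) *
       ((real_of_int \<alpha> + real_of_int \<beta> * sqrt (real_of_int D)) powr x
      - (real_of_int \<alpha> - real_of_int \<beta> * sqrt (real_of_int D)) powr x)"

definition pell_f :: "int \<Rightarrow> int \<Rightarrow> int \<Rightarrow> real \<Rightarrow> real" where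
  "pell_f D \<alpha> \<beta> x = pell_u D \<alpha> \<beta> x + pell_v D \<alpha> \<beta> x"

definition pell_g :: "int \<Rightarrow> int \<Rightarrow> int \<Rightarrow> real \<Rightarrow> real" where
  "pell_g D \<alpha> \<beta> = the_inv_into {0..} (pell_f D \<alpha> \<beta>)"

text \<open>
  The remaining lemmas show that no junk value is involved: \<open>f\<close> is a strictly increasing bijection
  from \<open>[0,\<infinity>)\<close> onto \<open>[1,\<infinity>)\<close>, the function \<open>arcosh\<close> is on \<open>[1,\<infinity>)\<close> the inverse of \<open>cosh\<close> restricted
  to \<open>[0,\<infinity>)\<close>, and the roots and logarithms of the closed formulas for \<open>g\<close> are taken inside their
  domains.
\<close>

lemma pell_nonsquare_ge_2:
  assumes "0 < D" "\<not> is_square (D :: int)"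
  shows "2 \<le> D"
proof -
  have "D \<noteq> 1"
    using assms(2) by (metis is_nth_power_def power_one)
  with assms(1) show ?thesis by simp
qed

lemma pell_conjugate:
  assumes "0 < D" "pell_pos_solution D \<alpha> \<beta>"
  defines "e \<equiv> real_of_int \<alpha> + real_of_int \<beta> * sqrt (real_of_int D)"
  shows "1 < e" and "real_of_int \<alpha> - real_of_int \<beta> * sqrt (real_of_int D) = 1 / e"
proof -
  have pos: "1 \<le> real_of_int \<alpha>" "0 < real_of_int \<beta>"
    and eq: "real_of_int (\<alpha>\<^sup>2 - D * \<beta>\<^sup>2) = 1"
    using assms(2) by (auto simp: pell_pos_solution_def)
  have "0 < real_of_int \<beta> * sqrt (real_of_int D)"
    using pos assms(1) by simp
  then show e: "1 < e"
    unfolding e_def using pos by linarith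
  have "(real_of_int \<alpha> - real_of_int \<beta> * sqrt (real_of_int D)) * e
      = (real_of_int \<alpha>)\<^sup>2 - (real_of_int \<beta>)\<^sup>2 * (sqrt (real_of_int D))\<^sup>2"
    unfolding e_def by (simp add: algebra_simps power2_eq_square)
  also have "\<dots> = 1"
    using eq assms(1) by (simp add: algebra_simps)
  finally show "real_of_int \<alpha> - real_of_int \<beta> * sqrt (real_of_int D) = 1 / e"
    using e by (simp add: field_simps)
qed

lemma pell_f_eq:
  assumes "0 < D" "pell_pos_solution D \<alpha> \<beta>"
  defines "e \<equiv> real_of_int \<alpha> + real_of_int \<beta> * sqrt (real_of_int D)"
  shows "pell_f D \<alpha> \<beta> x = (1 + 1 / sqrt (real_of_int D)) / 2 * e powr x
                        + (1 - 1 / sqrt (real_of_int D)) / 2 * (1 / e powr x)"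
proof -
  have e: "1 < e" and c: "real_of_int \<alpha> - real_of_int \<beta> * sqrt (real_of_int D) = 1 / e"
    using pell_conjugate[OF assms(1,2)] by (simp_all add: e_def)
  have "(1 / e) powr x = 1 / e powr x"
    using e by (simp add: powr_divide)
  moreover have "1 / 2 * (p + q) + 1 / (2 * r) * (p - q) = (1 + 1 / r) / 2 * p + (1 - 1 / r) / 2 * q"
    for p q r :: real
    by (simp add: algebra_simps add_divide_distrib diff_divide_distrib)
  ultimately show ?thesis
    unfolding pell_f_def pell_u_def pell_v_def c e_def[symmetric] by simp
qed

lemma pell_f_strict_mono_on:
  assumes "0 < D" "pell_pos_solution D \<alpha> \<beta>"
  shows "strict_mono_on {0..} (pell_f D \<alpha> \<beta>)"
proof (rule strict_mono_onI)
  fix x y :: real assume xy: "x \<in> {0..}" "y \<in> {0..}" "x < y"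
  define e where "e = real_of_int \<alpha> + real_of_int \<beta> * sqrt (real_of_int D)"
  define t where "t = 1 / sqrt (real_of_int D)"
  have t: "0 < t" "t \<le> 1"
    using assms(1) by (auto simp: t_def)
  have e: "1 < e"
    using pell_conjugate(1)[OF assms] by (simp add: e_def)
  define X Y where "X = e powr x" and "Y = e powr y"
  have X: "1 \<le> X" and XY: "X < Y"
    using e xy by (auto simp: X_def Y_def ge_one_powr_ge_zero)
  have "1 < X * Y"
    using X XY by (smt (verit) mult_le_cancel_right1)
  then have "(1 - t) / (X * Y) \<le> 1 - t"
    using t by (simp add: divide_le_eq mult_le_cancel_left1)
  then have "0 < (1 + t) - (1 - t) / (X * Y)"
    using t by linarith
  then have "0 < (Y - X) * ((1 + t) - (1 - t) / (X * Y))"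
    using XY by simp
  also have "\<dots> = 2 * (pell_f D \<alpha> \<beta> y - pell_f D \<alpha> \<beta> x)"
    unfolding pell_f_eq[OF assms] e_def[symmetric] t_def[symmetric]
      X_def[symmetric] Y_def[symmetric]
    using X XY by (simp add: field_simps)
  finally show "pell_f D \<alpha> \<beta> x < pell_f D \<alpha> \<beta> y" by simp
qed

lemma pell_f_bij_betw:
  assumes "0 < D" "pell_pos_solution D \<alpha> \<beta>"
  shows "bij_betw (pell_f D \<alpha> \<beta>) {0..} {1..}"
proof -
  define e where "e = real_of_int \<alpha> + real_of_int \<beta> * sqrt (real_of_int D)"
  define t where "t = 1 / sqrt (real_of_int D)"
  have t: "0 < t" "t \<le> 1"
    using assms(1) by (auto simp: t_def)
  have e: "1 < e"
    using pell_conjugate(1)[OF assms] by (simp add: e_def)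
  note feq = pell_f_eq[OF assms, folded e_def t_def]
  have f0: "pell_f D \<alpha> \<beta> 0 = 1"
    using e by (simp add: feq field_simps)
  have mono: "strict_mono_on {0..} (pell_f D \<alpha> \<beta>)"
    by (rule pell_f_strict_mono_on[OF assms])
  have ge: "1 \<le> pell_f D \<alpha> \<beta> x" if "0 \<le> x" for x
    using strict_mono_onD[OF mono, of 0 x] that f0 by (cases "x = 0") auto
  have surj: "\<exists>x\<ge>0. pell_f D \<alpha> \<beta> x = y" if y: "1 \<le> y" for y
  proof -
    define b where "b = ln (2 * y) / ln e"
    have b: "0 \<le> b" "e powr b = 2 * y"
      using e y by (auto simp: b_def powr_def)
    have "y \<le> (1 + t) / 2 * (2 * y)"
      using t y by (simp add: algebra_simps)
    also have "\<dots> \<le> pell_f D \<alpha> \<beta> b"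
      using t y by (simp add: feq b(2))
    finally have yb: "y \<le> pell_f D \<alpha> \<beta> b" .
    have "continuous_on {0..b} (\<lambda>x. (1 + t) / 2 * e powr x + (1 - t) / 2 * (1 / e powr x))"
      using e by (intro continuous_intros) auto
    then have "continuous_on {0..b} (pell_f D \<alpha> \<beta>)"
      by (simp add: feq cong: continuous_on_cong)
    from IVT'[OF _ yb b(1) this] y f0 show ?thesis by auto
  qed
  show ?thesis
    unfolding bij_betw_def using strict_mono_on_imp_inj_on[OF mono] ge surj by force
qed

lemma arcosh_eq_the_inv_into_cosh:
  assumes "(1 :: real) \<le> x"
  shows "arcosh x = the_inv_into {0..} cosh x"
proof -
  have "inj_on cosh {(0 :: real)..}"
    by (rule inj_on_inverseI[where g = arcosh]) (simp add: arcosh_cosh_real)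
  from the_inv_into_f_f[OF this, of "arcosh x"] assms show ?thesis by simp
qed

lemma pell_formula_domain:
  fixes D :: int and x :: real
  assumes "2 \<le> D" "1 \<le> x"
  defines "d \<equiv> real_of_int D"
  defines "s \<equiv> sqrt (d * x\<^sup>2 - d + 1)"
  shows "0 < d * x\<^sup>2 - d + 1"
    and "1 \<le> (d * x - s) / (d - 1)"
    and "0 \<le> (d + 1) * x\<^sup>2 - d + 1 - 2 * x * s"
    and "0 < d * x - s + sqrt d * sqrt ((d + 1) * x\<^sup>2 - d + 1 - 2 * x * s)"
proof -
  have d: "2 \<le> d" using assms(1) by (simp add: d_def)
  have x2: "1 \<le> x\<^sup>2" using assms(2) by simp
  then have "d * 1 \<le> d * x\<^sup>2" using d by (intro mult_left_mono) auto
  then show rad: "0 < d * x\<^sup>2 - d + 1" by simp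
  have s2: "s\<^sup>2 = d * x\<^sup>2 - d + 1" using rad by (simp add: s_def)
  have "(d * x - (d - 1))\<^sup>2 - (d * x\<^sup>2 - d + 1) = d * (d - 1) * (x - 1)\<^sup>2"
    by (simp add: power2_eq_square algebra_simps)
  moreover have "0 \<le> d * (d - 1) * (x - 1)\<^sup>2" using d by simp
  ultimately have "d * x\<^sup>2 - d + 1 \<le> (d * x - (d - 1))\<^sup>2" by linarith
  moreover have "d * 1 \<le> d * x" using d assms(2) by (intro mult_left_mono) auto
  ultimately have s_le: "s \<le> d * x - (d - 1)"
    unfolding s_def by (intro real_le_lsqrt) auto
  then show "1 \<le> (d * x - s) / (d - 1)" using d by (simp add: field_simps)
  have "(d + 1) * x\<^sup>2 - d + 1 - 2 * x * s = (s - x)\<^sup>2"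
    using s2 by (simp add: power2_eq_square algebra_simps)
  then show nn: "0 \<le> (d + 1) * x\<^sup>2 - d + 1 - 2 * x * s" by simp
  have "0 \<le> sqrt d * sqrt ((d + 1) * x\<^sup>2 - d + 1 - 2 * x * s)" using nn d by simp
  then show "0 < d * x - s + sqrt d * sqrt ((d + 1) * x\<^sup>2 - d + 1 - 2 * x * s)"
    using s_le d by linarith
qed

end

theory Submission
  imports Defs
begin

text \<open>
  Put \<open>t = g x\<close>, \<open>u = u t\<close>, \<open>v = v t\<close>, so that \<open>x = u + v\<close> and \<open>u\<^sup>2 - D v\<^sup>2 = 1\<close>. Eliminating the
  constant \<open>1\<close> gives \<open>D x\<^sup>2 - D + 1 = (u + D v)\<^sup>2\<close>, whence \<open>D x - sqrt (D x\<^sup>2 - D + 1) = (D - 1) u\<close>,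
  while the inner radicand of the logarithmic formula is \<open>((D - 1) v)\<^sup>2\<close>. Both formulas follow
  from \<open>u = cosh (t * ln e)\<close> and \<open>u + sqrt D * v = e powr t\<close> with \<open>e = \<alpha> + \<beta> sqrt D\<close>.
\<close>

text \<open>By the Pell equation the conjugate of \<open>e\<close> is \<open>1 / e\<close>, so the
  two powers in \<open>u\<close> and \<open>v\<close> are \<open>exp\<close> of
  \<open>t * ln e\<close> and of its negative.\<close>

lemma pell_u_v_hyperbolic:
  assumes "0 < D" "pell_pos_solution D \<alpha> \<beta>"
  defines "e \<equiv> real_of_int \<alpha> + real_of_int \<beta> * sqrt (real_of_int D)"
  shows "pell_u D \<alpha> \<beta> t = cosh (t * ln e)"
    and "pell_v D \<alpha> \<beta> t = sinh (t * ln e) / sqrt (real_of_int D)"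
proof -
  have e: "1 < e" and c: "real_of_int \<alpha> - real_of_int \<beta> * sqrt (real_of_int D) = 1 / e"
    using pell_conjugate[OF assms(1,2)] by (simp_all add: e_def)
  have E: "e powr t = exp (t * ln e)" "(1 / e) powr t = exp (- (t * ln e))"
    using e by (simp_all add: powr_def ln_div)
  show "pell_u D \<alpha> \<beta> t = cosh (t * ln e)"
    unfolding pell_u_def c e_def[symmetric] E by (simp add: cosh_field_def)
  show "pell_v D \<alpha> \<beta> t = sinh (t * ln e) / sqrt (real_of_int D)"
    unfolding pell_v_def c e_def[symmetric] E by (simp add: sinh_field_def)
qed

text \<open>Replacing \<open>u\<^sup>2\<close> by \<open>1 + d * v\<^sup>2\<close> makes both
  radicands perfect squares; the sign hypotheses select the nonnegative root. In the second
  radicand, the nested root of the closed formula already appears as its value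
  \<open>u + d * v\<close>.\<close>

lemma pell_radicals:
  fixes d u v :: real
  assumes "0 \<le> d" "0 \<le> u" "0 \<le> v" "u\<^sup>2 - d * v\<^sup>2 = 1"
  shows "sqrt (d * (u + v)\<^sup>2 - d + 1) = u + d * v"
    and "1 \<le> d \<Longrightarrow> sqrt ((d + 1) * (u + v)\<^sup>2 - d + 1 - 2 * (u + v) * (u + d * v)) = (d - 1) * v"
proof -
  have u2: "u\<^sup>2 = 1 + d * v\<^sup>2" using assms(4) by simp
  have "d * (u + v)\<^sup>2 - d + 1 = (u + d * v)\<^sup>2"
    unfolding power2_sum power_mult_distrib u2 by (simp add: algebra_simps power2_eq_square)
  then show "sqrt (d * (u + v)\<^sup>2 - d + 1) = u + d * v"
    using assms by simp
  have "(d + 1) * (u + v)\<^sup>2 - d + 1 - 2 * (u + v) * (u + d * v)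
      = (d - 1) * u\<^sup>2 - d + 1 + (1 - d) * v\<^sup>2"
    by (simp add: algebra_simps power2_eq_square)
  also have "\<dots> = ((d - 1) * v)\<^sup>2"
    unfolding u2 by (simp add: algebra_simps power2_eq_square)
  finally show "sqrt ((d + 1) * (u + v)\<^sup>2 - d + 1 - 2 * (u + v) * (u + d * v)) = (d - 1) * v"
    if "1 \<le> d"
    using assms that by simp
qed

theorem theorem2p2:
  fixes D \<alpha> \<beta> :: int and x :: real
  assumes "0 < D"
    and "\<not> is_square D"
    and "pell_fundamental_solution D \<alpha> \<beta>"
    and "1 \<le> x"
  shows "pell_g D \<alpha> \<beta> x =
           1 / ln (real_of_int \<alpha> + real_of_int \<beta> * sqrt (real_of_int D)) *
           arcosh ((real_of_int D * x - sqrt (real_of_int D * x\<^sup>2 - real_of_int D + 1))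
                     / (real_of_int D - 1))
       \<and> pell_g D \<alpha> \<beta> x =
           (ln (real_of_int D * x - sqrt (real_of_int D * x\<^sup>2 - real_of_int D + 1)
                + sqrt (real_of_int D) *
                  sqrt ((real_of_int D + 1) * x\<^sup>2 - real_of_int D + 1
                        - 2 * x * sqrt (real_of_int D * x\<^sup>2 - real_of_int D + 1)))
            - ln (real_of_int D - 1))
           / ln (real_of_int \<alpha> + real_of_int \<beta> * sqrt (real_of_int D))"
proof -
  define d where "d = real_of_int D"
  define e where "e = real_of_int \<alpha> + real_of_int \<beta> * sqrt d"
  define t where "t = pell_g D \<alpha> \<beta> x"
  define u v where "u = pell_u D \<alpha> \<beta> t" and "v = pell_v D \<alpha> \<beta> t"
  have sol: "pell_pos_solution D \<alpha> \<beta>"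
    using assms(3) by (simp add: pell_fundamental_solution_def)
  have d: "2 \<le> d"
    using pell_nonsquare_ge_2[OF assms(1,2)] by (simp add: d_def)
  have e: "0 < ln e"
    using pell_conjugate(1)[OF assms(1) sol] by (simp add: e_def d_def)
  note bij = pell_f_bij_betw[OF assms(1) sol]
  \<comment> \<open>This sign gives \<open>0 \<le> v\<close>, and it lets \<open>arcosh\<close> undo
    \<open>cosh\<close> at \<open>t * ln e\<close>.\<close>
  have t: "0 \<le> t"
    using bij_betw_apply[OF bij_betw_the_inv_into[OF bij], of x] assms(4)
    by (simp add: t_def pell_g_def)
  have x: "x = u + v"
    using f_the_inv_into_f_bij_betw[OF bij, of x] assms(4)
    by (simp add: t_def u_def v_def pell_g_def pell_f_def)
  have u: "u = cosh (t * ln e)" and v: "v = sinh (t * ln e) / sqrt d"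
    using pell_u_v_hyperbolic[OF assms(1) sol] by (simp_all add: u_def v_def e_def d_def)
  have uv: "0 \<le> u" "0 \<le> v" "u\<^sup>2 - d * v\<^sup>2 = 1"
    using t e d by (auto simp: u v power_divide cosh_square_eq)
  have sq: "sqrt (d * x\<^sup>2 - d + 1) = u + d * v"
    using pell_radicals(1)[of d u v] uv d by (simp add: x)
  have sq': "sqrt ((d + 1) * x\<^sup>2 - d + 1 - 2 * x * (u + d * v)) = (d - 1) * v"
    using pell_radicals(2)[of d u v] uv d by (simp add: x)
  have diff: "d * x - (u + d * v) = (d - 1) * u"
    by (simp add: x algebra_simps)
  have "arcosh ((d * x - (u + d * v)) / (d - 1)) = t * ln e"
    unfolding diff using d t e by (simp add: u arcosh_cosh_real)
  moreover have "ln (d * x - (u + d * v) + sqrt d * ((d - 1) * v)) - ln (d - 1) = t * ln e"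
  proof -
    \<comment> \<open>The positive common factor \<open>d - 1\<close> splits off under the logarithm
      and cancels \<open>ln (d - 1)\<close>.\<close>
    have "(d - 1) * u + sqrt d * ((d - 1) * v) = (d - 1) * (u + sqrt d * v)"
      by (simp add: algebra_simps)
    also have "u + sqrt d * v = exp (t * ln e)"
      using d cosh_plus_sinh[of "t * ln e"] by (simp add: u v)
    finally show ?thesis
      unfolding diff using d by (simp add: ln_mult)
  qed
  ultimately show ?thesis
    unfolding d_def[symmetric] e_def[symmetric] t_def[symmetric] sq sq' using e by simp
qed

end
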